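(* There exist infinitely many (pairwise non-isomorphic) $2$-connected $6$-regular graphs $G$ with $\chi_c'(G) = 7$.
   Context: Graphs are finite and simple (no loops, no parallel edges). For a real number $r$, a circular $r$-edge-colouring of $G$ is a map $c$ assigning to each edge of $G$ a real number in $[0,r)$ such that any two distinct edges $e,f$ sharing an end-vertex satisfy $1\le |c(e)-c(f)|\le r-1$. The circular chromatic index $\chi_c'(G)$ is the infimum (attained for finite graphs) of all $r$ such that $G$ admits a circular $r$-edge-colouring. "$2$-connected" refers to vertex connectivity. *)

theory Defs
  imports Complex_Main
begin

record 'a ugraph =
  verts :: "'a set"
  edges :: "'a set set"

definition simple_graph :: "'a ugraph \<Rightarrow> bool" where
  "simple_graph G \<longleftrightarrow>
     finite (verts G) \<and> (\<forall>e \<in> edges G. e \<subseteq> verts G \<and> card e = 2)"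

definition degree :: "'a ugraph \<Rightarrow> 'a \<Rightarrow> nat" where
  "degree G v = card {e \<in> edges G. v \<in> e}"

definition regular :: "nat \<Rightarrow> 'a ugraph \<Rightarrow> bool" where
  "regular k G \<longleftrightarrow> (\<forall>v \<in> verts G. degree G v = k)"

definition delete_verts :: "'a ugraph \<Rightarrow> 'a set \<Rightarrow> 'a ugraph" where
  "delete_verts G X =
     \<lparr>verts = verts G - X, edges = {e \<in> edges G. e \<inter> X = {}}\<rparr>"

definition connected_graph :: "'a ugraph \<Rightarrow> bool" where
  "connected_graph G \<longleftrightarrow>
     verts G \<noteq> {} \<and>
     (\<forall>u \<in> verts G. \<forall>v \<in> verts G. (u, v) \<in> {(x, y). {x, y} \<in> edges G}\<^sup>*)"

definition k_connected :: "nat \<Rightarrow> 'a ugraph \<Rightarrow> bool" where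
  "k_connected k G \<longleftrightarrow>
     card (verts G) > k \<and>
     (\<forall>X \<subseteq> verts G. card X < k \<longrightarrow> connected_graph (delete_verts G X))"

definition isomorphic :: "'a ugraph \<Rightarrow> 'b ugraph \<Rightarrow> bool" where
  "isomorphic G H \<longleftrightarrow>
     (\<exists>f. bij_betw f (verts G) (verts H) \<and>
          (\<forall>u \<in> verts G. \<forall>v \<in> verts G. {u, v} \<in> edges G \<longleftrightarrow> {f u, f v} \<in> edges H))"

definition circular_edge_colouring :: "real \<Rightarrow> 'a ugraph \<Rightarrow> ('a set \<Rightarrow> real) \<Rightarrow> bool" where
  "circular_edge_colouring r G c \<longleftrightarrow>
     (\<forall>e \<in> edges G. 0 \<le> c e \<and> c e < r) \<and>
     (\<forall>e \<in> edges G. \<forall>f \<in> edges G. e \<noteq> f \<and> e \<inter> f \<noteq> {} \<longrightarrow>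
        1 \<le> \<bar>c e - c f\<bar> \<and> \<bar>c e - c f\<bar> \<le> r - 1)"

text \<open>
  If \<open>G\<close> is a simple graph with at least one edge, the set below is nonempty and contains only
  positive reals, so \<open>Inf\<close> is the genuine infimum. On edgeless graphs every real \<open>r\<close> qualifies
  and the value is meaningless.
\<close>

definition circular_chromatic_index :: "'a ugraph \<Rightarrow> real" where
  "circular_chromatic_index G = Inf {r. \<exists>c. circular_edge_colouring r G c}"

end

theory Submission
  imports Defs
begin

text \<open>
  Arrange at least two copies of \<open>K\<^sub>7\<close> minus an edge in a ring. Each copy \<open>X\<close> has only two boundary
  edges \<open>a\<close> and \<open>b\<close>, and this alone excludes circular \<open>r\<close>-edge-colourings with \<open>r < 7\<close>.

  Scale such a colouring so that adjacent colours differ by more than 1 and less than 6, and take floors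
  modulo 7. This is a proper colouring, and it stays proper while the edges are recoloured one at
  a time from \<open>i\<close> to \<open>i + 1\<close> in the order of decreasing fractional parts. Each vertex
  of \<open>X\<close> misses exactly one colour. If \<open>\<mu> i\<close> vertices of \<open>X\<close> miss \<open>i\<close> and \<open>d i\<close> of the edges \<open>a\<close>, \<open>b\<close>
  have colour \<open>i\<close>, then \<open>\<mu> i + d i\<close> is odd, and the seven sums add up to \<open>9\<close>; so one of them is \<open>3\<close> and the
  others are \<open>1\<close>. Recolouring an inner edge of colour \<open>i\<close> requires that both ends miss \<open>i + 1\<close>, and
  afterwards both miss \<open>i\<close>, so consecutively recoloured inner edges have colours \<open>i\<close>, \<open>i - 1\<close>, \<open>i - 2\<close>,
  \<open>\<dots>\<close>. If \<open>a\<close> or \<open>b\<close> has colour \<open>i\<close>, then only the two ends of the edge just recoloured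
  miss \<open>i\<close> and the run stops. Hence a run not interrupted by \<open>a\<close> or \<open>b\<close> has at most 6 members, and
  the three runs cannot exhaust the 20 inner edges.
\<close>

section \<open>A seven-vertex set with two boundary edges\<close>

lemma double_count_incidence:
  assumes "finite X" "finite F"
  shows "(\<Sum>v\<in>X. card {e \<in> F. v \<in> e}) = (\<Sum>e\<in>F. card (e \<inter> X))"
proof -
  have "(\<Sum>v\<in>X. card {e \<in> F. v \<in> e}) = (\<Sum>v\<in>X. \<Sum>e\<in>F. if v \<in> e then 1 else 0)"
    using assms by (simp add: sum.If_cases Int_def)
  also have "\<dots> = (\<Sum>e\<in>F. \<Sum>v\<in>X. if v \<in> e then 1 else 0)"
    by (rule sum.swap)
  also have "\<dots> = (\<Sum>e\<in>F. card (e \<inter> X))"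
    using assms by (simp add: sum.If_cases Int_def conj_commute)
  finally show ?thesis .
qed

section \<open>Rounding real colours to residues modulo 7\<close>

text \<open>Read \<open>P\<close> and \<open>Q\<close> as "x is pushed" and "y is pushed". Equal
  residues force the floors to differ by \<open>7 * t + of_bool Q - of_bool P\<close> with
  \<open>t\<close> in {-1, 0, 1}. If \<open>P = Q\<close>, this contradicts the bounds on the
  distance of \<open>x\<close> and \<open>y\<close>. If just one number is pushed, its fractional
  part must be the smaller one, and then the other should have been pushed as well.\<close>

lemma shifted_floor_neq:
  fixes x y :: real
  assumes xy: "1 < \<bar>x - y\<bar>" "\<bar>x - y\<bar> < 6"
    and "P \<Longrightarrow> frac x < frac y \<Longrightarrow> Q" "Q \<Longrightarrow> frac y < frac x \<Longrightarrow> P"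
  shows "(\<lfloor>x\<rfloor> + of_bool P) mod 7 \<noteq> (\<lfloor>y\<rfloor> + of_bool Q) mod 7"
proof
  define m n where "m = \<lfloor>x\<rfloor>" and "n = \<lfloor>y\<rfloor>"
  have fr: "x = m + frac x" "y = n + frac y" "0 \<le> frac x" "frac x < 1" "0 \<le> frac y" "frac y < 1"
    by (simp_all add: m_def n_def frac_def frac_lt_1) linarith+
  assume "(\<lfloor>x\<rfloor> + of_bool P) mod 7 = (\<lfloor>y\<rfloor> + of_bool Q) mod 7"
  then have "7 dvd (m + of_bool P) - (n + of_bool Q)" by (simp add: mod_eq_dvd_iff m_def n_def)
  then obtain t where t: "(m + of_bool P) - (n + of_bool Q) = 7 * t" by (auto elim: dvdE)
  have "real_of_int m - n < 7" "- 7 < real_of_int m - n" using fr xy by linarith+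
  then have mn: "m - n < 7" "- 7 < m - n" by linarith+
  then have "- 2 < t" "t < 2" using t by (auto simp: of_bool_def split: if_splits)
  then have t3: "t = - 1 \<or> t = 0 \<or> t = 1" by linarith
  define d where "d = real_of_int m - real_of_int n"
  have "m - n = 7 * t + of_bool Q - of_bool P" using t by simp
  then have d: "d = 7 * t + of_bool Q - of_bool P"
    unfolding d_def by (metis of_int_add of_int_diff of_int_mult of_int_numeral of_int_of_bool)
  have xyd: "x - y = d + frac x - frac y" using fr unfolding d_def by linarith
  consider "P = Q" | "P" "\<not> Q" | "\<not> P" "Q" by blast
  then show False
  proof cases
    case 1
    then have "d = - 7 \<or> d = 0 \<or> d = 7" using d t3 by auto
    then show False by (elim disjE) (use fr(3-) xyd xy in linarith)+
  next
    case 2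
    then have "d = - 8 \<or> d = - 1 \<or> d = 6" using d t3 by auto
    then have "frac x < frac y" by (elim disjE) (use fr(3-) xyd xy in linarith)+
    then show False using 2 assms(3) by blast
  next
    case 3
    then have "d = 8 \<or> d = 1 \<or> d = - 6" using d t3 by auto
    then have "frac y < frac x" by (elim disjE) (use fr(3-) xyd xy in linarith)+
    then show False using 3 assms(4) by blast
  qed
qed

text \<open>In the application \<open>E\<close> consists of the edges of a 6-regular graph that have
  an end in \<open>X\<close>; \<open>a\<close> and \<open>b\<close> are the two that leave
  \<open>X\<close>. Degrees are prescribed at vertices of \<open>X\<close> only, so the argument is
  local to \<open>X\<close>.\<close>

locale seven_set =
  fixes X :: "'a set" and E :: "'a set set" and a b :: "'a set"
  assumes card_X: "card X = 7"
    and finite_E: "finite E"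
    and card_edge: "e \<in> E \<Longrightarrow> card e = 2"
    and meets: "e \<in> E \<Longrightarrow> e \<inter> X \<noteq> {}"
    and deg: "v \<in> X \<Longrightarrow> card {e \<in> E. v \<in> e} = 6"
    and boundary: "{e \<in> E. \<not> e \<subseteq> X} = {a, b}"
    and a_neq_b: "a \<noteq> b"
begin

definition proper :: "('a set \<Rightarrow> int) \<Rightarrow> bool" where
  "proper k \<longleftrightarrow> (\<forall>e\<in>E. k e \<in> {0..<7}) \<and> (\<forall>v\<in>X. inj_on k {e \<in> E. v \<in> e})"

definition missing :: "('a set \<Rightarrow> int) \<Rightarrow> int \<Rightarrow> 'a set" where
  "missing k i = {v \<in> X. \<forall>e\<in>E. v \<in> e \<longrightarrow> k e \<noteq> i}"

definition boundary_count :: "('a set \<Rightarrow> int) \<Rightarrow> int \<Rightarrow> nat" where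
  "boundary_count k i = card {e \<in> {a, b}. k e = i}"

lemma finite_X: "finite X"
  using card_X card.infinite by fastforce

lemma ab_in_E: "a \<in> E" "b \<in> E"
  using boundary by auto

lemma finite_missing: "finite (missing k i)"
  using finite_X by (simp add: missing_def)

lemma card_edge_Int:
  assumes "e \<in> E"
  shows "card (e \<inter> X) = (if e \<in> {a, b} then 1 else 2)"
proof (cases "e \<in> {a, b}")
  case True
  then have "\<not> e \<subseteq> X" using boundary by blast
  moreover have "finite e" using card_edge[OF assms] card.infinite by fastforce
  ultimately have "card (e \<inter> X) < card e" by (intro psubset_card_mono) auto
  moreover have "card (e \<inter> X) \<noteq> 0" using meets[OF assms] finite_X by simp
  ultimately show ?thesis using True card_edge[OF assms] by auto
next
  case False
  then have "e \<subseteq> X" using boundary assms by blast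
  then show ?thesis using False card_edge[OF assms] by (simp add: Int_absorb2)
qed

lemma sum_card_edge_Int:
  assumes "F \<subseteq> E"
  shows "(\<Sum>e\<in>F. card (e \<inter> X)) = 2 * card (F - {a, b}) + card (F \<inter> {a, b})"
proof -
  have fin: "finite F" using assms finite_E finite_subset by blast
  have "(\<Sum>e\<in>F. card (e \<inter> X)) = (\<Sum>e\<in>F. if e \<in> {a, b} then 1 else 2)"
    using assms by (intro sum.cong refl card_edge_Int) auto
  also have "\<dots> = card (F \<inter> {a, b}) + 2 * card (F - {a, b})"
    using fin by (subst sum.If_cases) (simp_all add: Diff_eq Int_def)
  finally show ?thesis by simp
qed

text \<open>Seven vertices of degree 6 give 42 incidences. Inner edges count twice and
  \<open>a\<close>, \<open>b\<close> once, so there are 20 inner edges.\<close>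

lemma card_E: "card E = 22"
proof -
  have "42 = (\<Sum>v\<in>X. card {e \<in> E. v \<in> e})" using deg card_X by simp
  also have "\<dots> = 2 * card (E - {a, b}) + card (E \<inter> {a, b})"
    using double_count_incidence[OF finite_X finite_E] sum_card_edge_Int[of E] by simp
  finally have eq: "2 * card (E - {a, b}) + card (E \<inter> {a, b}) = 42" by simp
  have "E \<inter> {a, b} = {a, b}" using ab_in_E by blast
  then have c2: "card (E \<inter> {a, b}) = 2" using a_neq_b by simp
  have "card (E - {a, b}) = card E - 2"
    using card_Diff_subset[of "{a,b}" E] ab_in_E a_neq_b by simp
  moreover have "card E \<ge> 2"
    using card_mono[OF finite_E, of "{a,b}"] ab_in_E a_neq_b by simp
  ultimately show ?thesis using eq c2 by simp
qed

section \<open>Parity and counting of missing colours\<close>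

text \<open>Each vertex of \<open>X\<close> that does not miss \<open>i\<close> lies on exactly one
  edge of colour \<open>i\<close>. Counting these vertices by edges, inner edges contribute 2 and
  boundary edges 1; the parity follows because \<open>X\<close> has odd size.\<close>

lemma missing_parity:
  assumes "proper k"
  shows "odd (card (missing k i) + boundary_count k i)"
proof -
  let ?F = "{e \<in> E. k e = i}"
  have one: "card {e \<in> ?F. v \<in> e} = (if v \<in> missing k i then 0 else 1)" if v: "v \<in> X" for v
  proof (cases "v \<in> missing k i")
    case True
    then have "{e \<in> ?F. v \<in> e} = {}" by (auto simp: missing_def)
    then show ?thesis using True by (simp only: card.empty if_True)
  next
    case False
    then obtain e where e: "e \<in> E" "v \<in> e" "k e = i" using v by (auto simp: missing_def)
    have "inj_on k {e \<in> E. v \<in> e}" using assms v by (simp add: proper_def)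
    then have "{e \<in> ?F. v \<in> e} = {e}" using e by (auto dest: inj_onD)
    then show ?thesis using False by (simp only: card_1_singleton_iff if_False) auto
  qed
  have sub: "missing k i \<subseteq> X" by (auto simp: missing_def)
  have "(\<Sum>v\<in>X. card {e \<in> ?F. v \<in> e}) = (\<Sum>v\<in>X. if v \<in> missing k i then 0 else 1)"
    using one by (intro sum.cong) auto
  also have "\<dots> = card (X - missing k i)"
    using finite_X by (subst sum.If_cases) (auto simp: Diff_eq)
  also have "\<dots> = 7 - card (missing k i)"
    using sub finite_missing card_X by (simp add: card_Diff_subset)
  finally have "7 - card (missing k i) = 2 * card (?F - {a, b}) + card (?F \<inter> {a, b})"
    using double_count_incidence[OF finite_X, of ?F] finite_E sum_card_edge_Int[of ?F] by simp
  moreover have "?F \<inter> {a, b} = {e \<in> {a, b}. k e = i}" using ab_in_E by auto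
  moreover have "card (missing k i) \<le> 7"
    using card_mono[OF finite_X sub] card_X by simp
  ultimately have "7 = 2 * card (?F - {a, b}) + (card (missing k i) + boundary_count k i)"
    unfolding boundary_count_def by simp
  moreover have "odd m" if "7 = 2 * n + m" for m n :: nat using that by presburger
  ultimately show ?thesis by blast
qed

text \<open>The six edges at a vertex have six different colours out of seven, so each vertex is
  counted for exactly one colour.\<close>

lemma sum_card_missing:
  assumes "proper k"
  shows "(\<Sum>i\<in>{0..<7}. card (missing k i)) = 7"
proof -
  have one: "card {i \<in> {0..<7}. v \<in> missing k i} = 1" if v: "v \<in> X" for v
  proof -
    have im: "k ` {e \<in> E. v \<in> e} \<subseteq> {0..<7}" using assms by (auto simp: proper_def)
    have "card (k ` {e \<in> E. v \<in> e}) = 6"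
      using assms v deg by (simp add: proper_def card_image)
    then have "card ({0..<7} - k ` {e \<in> E. v \<in> e}) = 1"
      using im finite_E by (subst card_Diff_subset) auto
    moreover have "{i \<in> {0..<7}. v \<in> missing k i} = {0..<7} - k ` {e \<in> E. v \<in> e}"
      using v by (auto simp: missing_def)
    ultimately show ?thesis by simp
  qed
  have "(\<Sum>i\<in>{0..<7}. card (missing k i)) = (\<Sum>i\<in>{0..<7::int}. \<Sum>v\<in>X. if v \<in> missing k i then 1 else 0)"
  proof (rule sum.cong[OF refl])
    fix i :: int
    have "{v \<in> X. v \<in> missing k i} = missing k i" by (auto simp: missing_def)
    then show "card (missing k i) = (\<Sum>v\<in>X. if v \<in> missing k i then 1 else 0)"
      using finite_X by (simp add: sum.If_cases Int_def)
  qed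
  also have "\<dots> = (\<Sum>v\<in>X. \<Sum>i\<in>{0..<7::int}. if v \<in> missing k i then 1 else 0)"
    by (rule sum.swap)
  also have "\<dots> = (\<Sum>v\<in>X. card {i \<in> {0..<7}. v \<in> missing k i})"
    by (simp add: sum.If_cases Int_def conj_commute)
  also have "\<dots> = 7" using one card_X by simp
  finally show ?thesis .
qed

lemma sum_boundary_count:
  assumes "proper k"
  shows "(\<Sum>i\<in>{0..<7}. boundary_count k i) = 2"
proof -
  have k: "k a \<in> {0..<7}" "k b \<in> {0..<7}" using assms ab_in_E by (auto simp: proper_def)
  have "boundary_count k i = (if i = k a then 1 else 0) + (if i = k b then 1 else 0)" for i
  proof -
    have "{e \<in> {a, b}. k e = i} = (if i = k a then {a} else {}) \<union> (if i = k b then {b} else {})"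
      by auto
    then show ?thesis using a_neq_b by (simp add: boundary_count_def)
  qed
  then show ?thesis using k by (simp add: sum.distrib)
qed

text \<open>Seven odd positive numbers with sum 7 + 2 = 9 consist of one 3 and six 1s. A colour
  missed by two vertices must be the one with sum 3.\<close>

lemma missing_bounds:
  assumes k: "proper k" and p: "p \<in> {0..<7}" "card (missing k p) \<ge> 2"
  shows "card (missing k p) + boundary_count k p \<le> 3"
    and "q \<in> {0..<7} \<Longrightarrow> q \<noteq> p \<Longrightarrow> card (missing k q) \<le> 1"
proof -
  let ?s = "\<lambda>i. card (missing k i) + boundary_count k i"
  have tot: "(\<Sum>i\<in>{0..<7}. ?s i) = 9"
    using sum_card_missing[OF k] sum_boundary_count[OF k] by (simp add: sum.distrib)
  have odd: "odd (?s i)" for i using missing_parity[OF k] .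
  then have pos: "1 \<le> ?s i" for i by (metis One_nat_def Suc_leI odd_pos)
  have split: "(\<Sum>i\<in>{0..<7}. ?s i) = ?s p + (\<Sum>i\<in>{0..<7} - {p}. ?s i)"
    using p by (subst sum.remove[of _ p]) auto
  have "(\<Sum>i\<in>{0..<7} - {p}. 1) \<le> (\<Sum>i\<in>{0..<7} - {p}. ?s i)"
    by (intro sum_mono pos)
  moreover have "card ({0..<7} - {p}) = 6" using p by (subst card_Diff_singleton) auto
  ultimately have "?s p \<le> 3" using tot split by simp
  then show "?s p \<le> 3" .
  assume q: "q \<in> {0..<7}" "q \<noteq> p"
  have "?s p \<ge> 2" using p by simp
  then have p3: "?s p \<ge> 3" using odd[of p] by (cases "?s p = 2") auto
  have "(\<Sum>i\<in>{0..<7} - {p}. ?s i) = ?s q + (\<Sum>i\<in>{0..<7} - {p} - {q}. ?s i)"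
    using q by (subst sum.remove[of _ q]) auto
  moreover have "(\<Sum>i\<in>{0..<7} - {p} - {q}. 1) \<le> (\<Sum>i\<in>{0..<7} - {p} - {q}. ?s i)"
    by (intro sum_mono pos)
  moreover have "card ({0..<7} - {p} - {q}) = 5" using p q by (simp add: card_Diff_singleton)
  ultimately have "?s q \<le> 1" using tot split p3 by simp
  then show "card (missing k q) \<le> 1" by simp
qed

section \<open>Recolouring one edge at a time\<close>

text \<open>Another edge of the new colour at an end of \<open>e\<close> would clash with
  \<open>e\<close> after the push, and another edge of the old colour would clash with it
  before.\<close>

lemma missing_push:
  assumes k: "proper k" and e: "e \<in> E" "e \<subseteq> X"
    and k': "proper (k(e := (k e + 1) mod 7))"
  shows "e \<subseteq> missing k ((k e + 1) mod 7)"
    and "e \<subseteq> missing (k(e := (k e + 1) mod 7)) (k e)"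
proof -
  let ?k' = "k(e := (k e + 1) mod 7)"
  have range: "k e \<in> {0..<7}" using k e by (simp add: proper_def)
  then have ne: "(k e + 1) mod 7 \<noteq> k e" by simp presburger
  show "e \<subseteq> missing k ((k e + 1) mod 7)"
  proof
    fix v assume v: "v \<in> e"
    have inj: "inj_on ?k' {f \<in> E. v \<in> f}" using k' v e by (auto simp: proper_def)
    have "k f \<noteq> (k e + 1) mod 7" if f: "f \<in> E" "v \<in> f" for f
    proof (cases "f = e")
      case False
      show ?thesis
      proof
        assume "k f = (k e + 1) mod 7"
        then have "?k' f = ?k' e" using False by simp
        then show False using inj_onD[OF inj, of f e] f e v False by blast
      qed
    qed (use ne in simp)
    then show "v \<in> missing k ((k e + 1) mod 7)" using v e by (auto simp: missing_def)
  qed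
  show "e \<subseteq> missing ?k' (k e)"
  proof
    fix v assume v: "v \<in> e"
    have inj: "inj_on k {f \<in> E. v \<in> f}" using k v e by (auto simp: proper_def)
    have "?k' f \<noteq> k e" if f: "f \<in> E" "v \<in> f" for f
    proof (cases "f = e")
      case False
      show ?thesis
      proof
        assume "?k' f = k e"
        then have "k f = k e" using False by simp
        then show False using inj_onD[OF inj, of f e] f e v False by blast
      qed
    qed (use ne in simp)
    then show "v \<in> missing ?k' (k e)" using v e by (auto simp: missing_def)
  qed
qed

text \<open>Between the two pushes both ends of \<open>e\<close> miss its old colour and both ends
  of \<open>e'\<close> miss its target colour. Only one colour can be missed twice, so these agree.
  If \<open>a\<close> or \<open>b\<close> had this colour, just two vertices would miss it, and
  \<open>e\<close> and \<open>e'\<close> would be the same pair.\<close>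

lemma consecutive_pushes:
  assumes k: "proper k" and e: "e \<in> E" "e \<subseteq> X"
    and k': "k' = k(e := (k e + 1) mod 7)" "proper k'"
    and e': "e' \<in> E" "e' \<subseteq> X" "e' \<noteq> e"
    and k'': "proper (k'(e' := (k' e' + 1) mod 7))"
  shows "(k' e' + 1) mod 7 = k e" and "boundary_count k' (k e) = 0"
proof -
  have m: "e \<subseteq> missing k' (k e)" using missing_push(2)[OF k e] k' by simp
  have m': "e' \<subseteq> missing k' ((k' e' + 1) mod 7)" using missing_push(1)[OF k'(2) e'(1,2) k''] .
  have c: "card (missing k' (k e)) \<ge> 2"
    using card_mono[OF finite_missing m] card_edge[OF e(1)] by simp
  have c': "card (missing k' ((k' e' + 1) mod 7)) \<ge> 2"
    using card_mono[OF finite_missing m'] card_edge[OF e'(1)] by simp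
  have r: "k e \<in> {0..<7}" using k e by (simp add: proper_def)
  have r': "(k' e' + 1) mod 7 \<in> {0..<7}" by simp
  show eq: "(k' e' + 1) mod 7 = k e"
    using missing_bounds(2)[OF k'(2) r c r'] c' by linarith
  show "boundary_count k' (k e) = 0"
  proof (rule ccontr)
    assume "boundary_count k' (k e) \<noteq> 0"
    then have "card (missing k' (k e)) = 2" using missing_bounds(1)[OF k'(2) r c] c by simp
    then have "e = missing k' (k e)" "e' = missing k' (k e)"
      using card_subset_eq[OF finite_missing] m m' eq card_edge e(1) e'(1) by metis+
    then show False using e'(3) by simp
  qed
qed

text \<open>The pushed colours descend by 1 modulo 7, and \<open>a\<close> and \<open>b\<close>
  avoid the first six of them. Both therefore have the one remaining colour, which is the target of
  the first push; with the two ends of \<open>e 0\<close> missing it, its sum is at least 4.\<close>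

lemma seven_pushes_impossible:
  fixes k :: "nat \<Rightarrow> 'a set \<Rightarrow> int"
  assumes k: "\<And>n. n \<le> 7 \<Longrightarrow> proper (k n)"
    and step: "\<And>n. n < 7 \<Longrightarrow> k (Suc n) = (k n)(e n := (k n (e n) + 1) mod 7)"
    and e: "\<And>n. n < 7 \<Longrightarrow> e n \<in> E" "\<And>n. n < 7 \<Longrightarrow> e n \<subseteq> X"
    and inj: "inj_on e {..<7}"
  shows False
proof -
  define j where "j n = k n (e n)" for n
  have const: "k n f = k 0 f" if "n \<le> 7" "f \<in> {a, b}" for n f
    using that
  proof (induction n)
    case (Suc n)
    have "f \<noteq> e n" using e(2)[of n] Suc boundary by auto
    then show ?case using Suc step[of n] by simp
  qed simp
  have r: "j n \<in> {0..<7}" if "n < 7" for n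
    using k[of n] e(1)[of n] that by (auto simp: proper_def j_def)
  \<comment> \<open>The bound is 6 and not 7 because the last push has no successor to compare
    with.\<close>
  have cons: "(j (Suc n) + 1) mod 7 = j n \<and> boundary_count (k (Suc n)) (j n) = 0"
    if n: "n < 6" for n
  proof -
    have ne: "e (Suc n) \<noteq> e n" using inj_onD[OF inj, of "Suc n" n] n by auto
    have p: "proper ((k (Suc n))(e (Suc n) := (k (Suc n) (e (Suc n)) + 1) mod 7))"
      using k[of "Suc (Suc n)"] step[of "Suc n"] n by simp
    show ?thesis
      using consecutive_pushes[OF k[of n] e(1)[of n] e(2)[of n] step[of n] k[of "Suc n"]
          e(1)[of "Suc n"] e(2)[of "Suc n"] ne p] n
      by (simp add: j_def)
  qed
  have avoid: "k 0 f \<noteq> j n" if n: "n < 6" and f: "f \<in> {a, b}" for n f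
  proof
    assume "k 0 f = j n"
    then have "f \<in> {g \<in> {a, b}. k (Suc n) g = j n}" using const[of "Suc n" f] n f by auto
    moreover have "finite {g \<in> {a, b}. k (Suc n) g = j n}" by simp
    ultimately have "boundary_count (k (Suc n)) (j n) \<noteq> 0"
      unfolding boundary_count_def by (metis card_0_eq empty_iff)
    then show False using cons[OF n] by simp
  qed
  have seq: "j n = (j 0 - int n) mod 7" if "n < 6" for n
    using that
  proof (induction n)
    case 0
    then show ?case using r[of 0] by simp
  next
    case (Suc n)
    have "j (Suc n) = ((j (Suc n) + 1) mod 7 - 1) mod 7"
      using r[of "Suc n"] Suc.prems by (simp add: mod_simps)
    also have "\<dots> = (j 0 - int (Suc n)) mod 7"
      using cons[of n] Suc by (simp add: mod_simps algebra_simps)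
    finally show ?case .
  qed
  have last: "k 0 f = (j 0 + 1) mod 7" if f: "f \<in> {a, b}" for f
  proof -
    have range: "k 0 f \<in> {0..<7}" using k[of 0] f ab_in_E by (auto simp: proper_def)
    \<comment> \<open>\<open>n\<close> is the place of the colour of \<open>f\<close> in the
      descending sequence \<open>j 0\<close>, \<open>j 0 - 1\<close>, and so on. Places below 6 are
      excluded, and \<open>j 0 - 6\<close> is congruent to \<open>j 0 + 1\<close>.\<close>
    define n where "n = nat ((j 0 - k 0 f) mod 7)"
    have n: "int n = (j 0 - k 0 f) mod 7" by (simp add: n_def)
    have "(j 0 - int n) mod 7 = k 0 f" using range unfolding n by (simp add: mod_simps)
    then have "\<not> n < 6" using avoid[of n f] seq[of n] f by auto
    moreover have "n < 7" unfolding n_def by (simp add: nat_less_iff)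
    ultimately have "n = 6" by simp
    with \<open>(j 0 - int n) mod 7 = k 0 f\<close> show ?thesis by simp presburger
  qed
  then have "{f \<in> {a, b}. k 0 f = (j 0 + 1) mod 7} = {a, b}" by auto
  then have two: "boundary_count (k 0) ((j 0 + 1) mod 7) = 2"
    using a_neq_b by (simp add: boundary_count_def)
  have "e 0 \<subseteq> missing (k 0) ((j 0 + 1) mod 7)"
    using missing_push(1)[of "k 0" "e 0"] k[of 0] k[of 1] step[of 0] e[of 0] by (simp add: j_def)
  then have "card (missing (k 0) ((j 0 + 1) mod 7)) \<ge> 2"
    using card_mono[OF finite_missing, of "e 0"] card_edge[OF e(1)[of 0]] by simp
  then show False
    using missing_bounds(1)[OF k[of 0], of "(j 0 + 1) mod 7"] two by simp
qed

text \<open>The edges are pushed, i.e. recoloured from \<open>i\<close> to \<open>i + 1\<close> modulo 7, in the order of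
  decreasing fractional parts; this keeps the colouring proper.\<close>

lemma no_strict_colouring:
  fixes c :: "'a set \<Rightarrow> real"
  assumes c: "\<And>e f. e \<in> E \<Longrightarrow> f \<in> E \<Longrightarrow> e \<noteq> f \<Longrightarrow> e \<inter> f \<noteq> {} \<Longrightarrow>
    1 < \<bar>c e - c f\<bar> \<and> \<bar>c e - c f\<bar> < 6"
  shows False
proof -
  obtain es0 where es0: "set es0 = E" "distinct es0"
    using finite_distinct_list[OF finite_E] by blast
  define es where "es = sort_key (\<lambda>e. - frac (c e)) es0"
  have es: "set es = E" "distinct es" "sorted (map (\<lambda>e. - frac (c e)) es)"
    using es0 by (simp_all add: es_def)
  have len: "length es = 22" using distinct_card[OF es(2)] es(1) card_E by simp
  \<comment> \<open>\<open>K n\<close> is the floor colouring after the first \<open>n\<close> edges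
    of \<open>es\<close> have been pushed.\<close>
  define K where "K n e = (\<lfloor>c e\<rfloor> + of_bool (e \<in> set (take n es))) mod 7" for n e
  \<comment> \<open>The pushed edges are closed under strictly larger fractional parts, which is
    what \<open>shifted_floor_neq\<close> requires; ties may be ordered arbitrarily.\<close>
  have closed: "f \<in> set (take n es)"
    if e: "e \<in> set (take n es)" and f: "f \<in> E" and lt: "frac (c e) < frac (c f)" for n e f
  proof -
    obtain i where i: "i < n" "i < length es" "e = es ! i"
      using e by (auto simp: in_set_conv_nth)
    obtain l where l: "l < length es" "f = es ! l"
      using f es(1) by (metis in_set_conv_nth)
    have "l < i"
    proof (rule ccontr)
      assume "\<not> l < i"
      then show False using sorted_nth_mono[OF es(3), of i l] i l lt by simp
    qed
    then show ?thesis using i l by (auto simp: in_set_conv_nth intro!: exI[of _ l])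
  qed
  have proper: "proper (K n)" for n
  proof -
    have "inj_on (K n) {e \<in> E. v \<in> e}" for v
    proof (rule inj_onI, rule ccontr)
      fix e f assume ef: "e \<in> {e \<in> E. v \<in> e}" "f \<in> {e \<in> E. v \<in> e}" "K n e = K n f" "e \<noteq> f"
      then have "1 < \<bar>c e - c f\<bar> \<and> \<bar>c e - c f\<bar> < 6" by (intro c) auto
      then have "K n e \<noteq> K n f"
        unfolding K_def using closed[of e n f] closed[of f n e] ef
        by (intro shifted_floor_neq) auto
      with ef show False by simp
    qed
    then show ?thesis by (simp add: proper_def K_def)
  qed
  have step: "K (Suc n) = (K n)(es ! n := (K n (es ! n) + 1) mod 7)" if n: "n < 22" for n
  proof -
    have "es ! n \<notin> set (take n es)"
      using es(2) n len by (auto simp: in_set_conv_nth nth_eq_iff_index_eq)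
    then show ?thesis
      using n len by (auto simp: K_def take_Suc_conv_app_nth mod_simps fun_eq_iff)
  qed
  obtain i where i: "i < 22" "a = es ! i" using ab_in_E(1) es(1) len by (metis in_set_conv_nth)
  obtain l where l: "l < 22" "b = es ! l" using ab_in_E(2) es(1) len by (metis in_set_conv_nth)
  \<comment> \<open>The other 20 positions form at most three runs, so one run has length at least
    7. It starts at 0, just after the first boundary edge, or just after the second.\<close>
  have "\<exists>s. s + 7 \<le> 22 \<and> (\<forall>q<7. s + q \<noteq> i \<and> s + q \<noteq> l)"
  proof -
    consider "7 \<le> min i l" | "min i l < 7" "min i l + 8 \<le> max i l"
      | "min i l < 7" "max i l < min i l + 8" by linarith
    then show ?thesis
    proof cases
      case 1
      then show ?thesis by (intro exI[of _ 0]) auto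
    next
      case 2
      then show ?thesis using i l by (intro exI[of _ "Suc (min i l)"]) auto
    next
      case 3
      then show ?thesis by (intro exI[of _ "Suc (max i l)"]) auto
    qed
  qed
  then obtain s where s: "s + 7 \<le> 22" "\<And>q. q < 7 \<Longrightarrow> s + q \<noteq> i \<and> s + q \<noteq> l" by blast
  show False
  proof (rule seven_pushes_impossible[of "\<lambda>n. K (s + n)" "\<lambda>n. es ! (s + n)"])
    show "K (s + Suc n) = (K (s + n))(es ! (s + n) := (K (s + n) (es ! (s + n)) + 1) mod 7)"
      if "n < 7" for n using step[of "s + n"] s that by simp
    show E: "es ! (s + n) \<in> E" if "n < 7" for n
      using that s len es(1) by (metis add_less_cancel_left nth_mem order_less_le_trans)
    show "es ! (s + n) \<subseteq> X" if n: "n < 7" for n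
    proof -
      have "es ! (s + n) \<noteq> a" "es ! (s + n) \<noteq> b"
        using i l s(1) s(2)[OF n] n len es(2) by (simp_all add: nth_eq_iff_index_eq)
      then show ?thesis using E[OF n] boundary by blast
    qed
    show "inj_on (\<lambda>n. es ! (s + n)) {..<7}"
      using s(1) len es(2) by (auto intro!: inj_onI simp: nth_eq_iff_index_eq)
  qed (rule proper)
qed

end

section \<open>The lower bound for 6-regular graphs\<close>

lemma circular_colouring_ge_7:
  fixes G :: "'a ugraph"
  assumes G: "simple_graph G" "regular 6 G"
    and X: "X \<subseteq> verts G" "card X = 7" "card {e \<in> edges G. e \<inter> X \<noteq> {} \<and> \<not> e \<subseteq> X} = 2"
    and c: "circular_edge_colouring r G c"
  shows "7 \<le> r"
proof (rule ccontr)
  assume r: "\<not> 7 \<le> r"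
  define E where "E = {e \<in> edges G. e \<inter> X \<noteq> {}}"
  have "{e \<in> edges G. e \<inter> X \<noteq> {} \<and> \<not> e \<subseteq> X} = {e \<in> E. \<not> e \<subseteq> X}" by (auto simp: E_def)
  then obtain a b where ab: "{e \<in> E. \<not> e \<subseteq> X} = {a, b}" "a \<noteq> b"
    using X(3) by (auto simp: card_2_iff)
  have "edges G \<subseteq> Pow (verts G)" "finite (verts G)" using G(1) by (auto simp: simple_graph_def)
  then have fin: "finite E" unfolding E_def by (simp add: finite_subset)
  interpret seven_set X E a b
  proof
    show "card {e \<in> E. v \<in> e} = 6" if "v \<in> X" for v
    proof -
      have "{e \<in> E. v \<in> e} = {e \<in> edges G. v \<in> e}" using that by (auto simp: E_def)
      then show ?thesis using G(2) X(1) that by (auto simp: regular_def degree_def)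
    qed
  qed (use G X ab fin in \<open>auto simp: E_def simple_graph_def\<close>)
  have "a \<in> edges G" using ab_in_E by (simp add: E_def)
  \<comment> \<open>The colour of \<open>a\<close> lies between 0 and \<open>r\<close>, so the
    interval is nonempty.\<close>
  then have r0: "0 < r" using c by (fastforce simp: circular_edge_colouring_def)
  show False
  \<comment> \<open>Scaling by \<open>7 / r\<close> turns distances between 1 and
    \<open>r - 1\<close> into distances between \<open>7 / r\<close> and \<open>7 - 7 / r\<close>,
    strictly inside (1, 6) since \<open>r < 7\<close>.\<close>
  proof (rule no_strict_colouring[of "\<lambda>e. 7 / r * c e"])
    fix e f assume ef: "e \<in> E" "f \<in> E" "e \<noteq> f" "e \<inter> f \<noteq> {}"
    then have d: "1 \<le> \<bar>c e - c f\<bar>" "\<bar>c e - c f\<bar> \<le> r - 1"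
      using c by (auto simp: circular_edge_colouring_def E_def)
    have "\<bar>7 / r * c e - 7 / r * c f\<bar> = 7 / r * \<bar>c e - c f\<bar>"
      using r0 by (simp only: abs_mult abs_of_pos zero_less_divide_iff zero_less_numeral
          simp_thms flip: right_diff_distrib)
    moreover have "7 / r * 1 \<le> 7 / r * \<bar>c e - c f\<bar>" "7 / r * \<bar>c e - c f\<bar> \<le> 7 / r * (r - 1)"
      using d r0 by (intro mult_left_mono; simp)+
    moreover have "1 < 7 / r" "7 / r * (r - 1) < 6" using r r0 by (simp_all add: field_simps)
    ultimately show "1 < \<bar>7 / r * c e - 7 / r * c f\<bar> \<and> \<bar>7 / r * c e - 7 / r * c f\<bar> < 6" by simp
  qed
qed

section \<open>The ring of cliques\<close>

text \<open>Deleting at most one vertex of a Hamiltonian cycle leaves a connected graph.\<close>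

lemma hamiltonian_cycle_2_connected:
  assumes V: "verts G = {..<n}" "2 < n"
    and path: "\<And>i. Suc i < n \<Longrightarrow> {i, Suc i} \<in> edges G"
    and close: "{n - 1, 0} \<in> edges G"
  shows "k_connected 2 G"
  unfolding k_connected_def
proof (intro conjI allI impI)
  show "2 < card (verts G)" using V by simp
next
  fix X assume X: "X \<subseteq> verts G" "card X < 2"
  define R where "R = {(x, y). {x, y} \<in> edges (delete_verts G X)}"
  have sym: "(y, x) \<in> R\<^sup>*" if "(x, y) \<in> R\<^sup>*" for x y
  proof -
    have "sym R" by (auto simp: sym_def R_def insert_commute)
    then show ?thesis using that by (meson sym_rtrancl symD)
  qed
  have segment: "(i, j) \<in> R\<^sup>*" if "i \<le> j" "j < n" "{i..j} \<inter> X = {}" for i j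
    using that
  proof (induction j rule: dec_induct)
    case (step m)
    have ni: "i \<le> m" "m \<notin> X" "Suc m \<notin> X" "{i..m} \<inter> X = {}"
      using step.hyps step.prems by (auto simp: disjoint_iff)
    have "(i, m) \<in> R\<^sup>*" using step.IH step.prems ni by simp
    moreover have "(m, Suc m) \<in> R"
      using ni step.prems path[of m] by (simp add: R_def delete_verts_def)
    ultimately show ?case by simp
  qed simp
  \<comment> \<open>It suffices to reach one hub \<open>w\<close> from everywhere. The hub is 0, or
    \<open>n - 1\<close> if 0 itself is deleted; vertices beyond the deleted one reach 0 through the
    closing edge.\<close>
  have "\<exists>w. w \<in> verts G - X \<and> (\<forall>u \<in> verts G - X. (u, w) \<in> R\<^sup>*)"
  proof (cases "X = {}")
    case True
    then have "(u, 0) \<in> R\<^sup>*" if "u < n" for u using that by (intro sym[OF segment]) auto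
    then show ?thesis using True V by (intro exI[of _ 0]) auto
  next
    case False
    have "finite X" using X(1) V finite_subset by fastforce
    then have "card X = 1" using False X(2) by (simp add: less_2_cases_iff)
    then obtain z where z: "X = {z}" by (auto simp: card_1_singleton_iff)
    have up: "(u, n - 1) \<in> R\<^sup>*" if "z < u" "u < n" for u
      using that z by (intro segment) auto
    show ?thesis
    proof (cases "z = 0")
      case True
      then show ?thesis using up z V by (intro exI[of _ "n - 1"]) auto
    next
      case z0: False
      have "(u, 0) \<in> R\<^sup>*" if "u < n" "u \<noteq> z" for u
      proof (cases "u < z")
        case True
        then show ?thesis using z that by (intro sym[OF segment]) auto
      next
        case False
        then have "(n - 1, 0) \<in> R"
          using z z0 that close by (auto simp: R_def delete_verts_def)
        then show ?thesis using up[of u] False that by simp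
      qed
      then show ?thesis using z z0 V by (intro exI[of _ 0]) auto
    qed
  qed
  then obtain w where w: "w \<in> verts G - X" "\<And>u. u \<in> verts G - X \<Longrightarrow> (u, w) \<in> R\<^sup>*" by blast
  have "(u, v) \<in> R\<^sup>*" if "u \<in> verts G - X" "v \<in> verts G - X" for u v
    using rtrancl_trans[OF w(2) sym[OF w(2)]] that by blast
  then show "connected_graph (delete_verts G X)"
    using w(1) by (auto simp: connected_graph_def R_def delete_verts_def)
qed

text \<open>\<open>ring_nb N v s\<close> is the neighbour of \<open>v\<close> congruent to \<open>s\<close> modulo 7 in a cyclic arrangement of
  \<open>N\<close> copies of the complete graph on seven vertices, where each copy \<open>{7 * q..7 * q + 6}\<close> lacks the
  edge joining its end-points, which are instead joined to the adjacent copies.\<close>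

definition ring_nb :: "nat \<Rightarrow> nat \<Rightarrow> nat \<Rightarrow> nat" where
  "ring_nb N v s =
     (if v mod 7 = 0 \<and> s = 6 then if v = 0 then 7 * N - 1 else v - 1
      else if v mod 7 = 6 \<and> s = 0 then if Suc v = 7 * N then 0 else Suc v
      else 7 * (v div 7) + s)"

definition clique_ring :: "nat \<Rightarrow> nat ugraph" where
  "clique_ring N = \<lparr>verts = {..<7 * N},
     edges = {{v, ring_nb N v s} | v s. v < 7 * N \<and> s < 7 \<and> s \<noteq> v mod 7}\<rparr>"

text \<open>The third claim makes adjacency symmetric: from the neighbour, the residue of
  \<open>v\<close> leads back to \<open>v\<close>.\<close>

lemma ring_nb:
  assumes "v < 7 * N" "s < 7" "s \<noteq> v mod 7"
  shows ring_nb_less: "ring_nb N v s < 7 * N"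
    and ring_nb_mod: "ring_nb N v s mod 7 = s"
    and ring_nb_sym: "ring_nb N (ring_nb N v s) (v mod 7) = v"
proof -
  define q i where "q = v div 7" and "i = v mod 7"
  have v: "v = 7 * q + i" "i < 7" and si: "s < 7" "s \<noteq> i" and q: "q < N"
    using assms by (auto simp: q_def i_def less_mult_imp_div_less mult.commute)
  have dm: "(7 * m + j) div 7 = m" "(7 * m + j) mod 7 = j" if "j < 7" for m j :: nat
    using that by simp_all
  have "ring_nb N v s < 7 * N \<and> ring_nb N v s mod 7 = s \<and> ring_nb N (ring_nb N v s) i = v"
  proof -
    \<comment> \<open>The cases are: backward wrap from 0, step to the preceding copy, forward wrap
      to 0, step to the next copy, and an edge inside the copy.\<close>
    consider "i = 0" "s = 6" "q = 0" | p where "i = 0" "s = 6" "q = Suc p"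
      | "i = 6" "s = 0" "Suc q = N" | "i = 6" "s = 0" "Suc q < N"
      | "\<not> (i = 0 \<and> s = 6)" "\<not> (i = 6 \<and> s = 0)"
      using q by (metis Suc_lessI not0_implies_Suc)
    then show ?thesis
    proof cases
      case 1
      obtain M where M: "N = Suc M" using q by (cases N) auto
      then have "ring_nb N v s = 7 * M + 6" using 1 v by (simp add: ring_nb_def)
      then show ?thesis using 1 v M dm[of 6 M] by (simp add: ring_nb_def)
    next
      case 2
      then have "ring_nb N v s = 7 * p + 6" using v by (simp add: ring_nb_def)
      then show ?thesis using 2 v q dm[of 6 p] by (simp add: ring_nb_def)
    next
      case 3
      then have "ring_nb N v s = 0" using v dm[of 6 q] by (simp add: ring_nb_def)
      then show ?thesis using 3 v by (simp add: ring_nb_def)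
    next
      case 4
      then have "ring_nb N v s = 7 * Suc q" using v dm[of 6 q] by (simp add: ring_nb_def)
      then show ?thesis using 4 v by (simp add: ring_nb_def)
    next
      case 5
      then have "ring_nb N v s = 7 * q + s" using v dm[of i q] by (auto simp: ring_nb_def)
      then show ?thesis using 5 v si q dm[of s q] by (auto simp: ring_nb_def)
    qed
  qed
  then show "ring_nb N v s < 7 * N" "ring_nb N v s mod 7 = s"
    "ring_nb N (ring_nb N v s) (v mod 7) = v" by (simp_all add: i_def)
qed

lemma ring_edge:
  assumes "v < 7 * N" "s < 7" "s \<noteq> v mod 7"
  shows "{v, ring_nb N v s} \<in> edges (clique_ring N)"
  using assms by (auto simp: clique_ring_def)

text \<open>An edge generated from its other end can be rewritten from \<open>v\<close> by
  \<open>ring_nb_sym\<close>, so the residues other than that of \<open>v\<close> index all edges at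
  \<open>v\<close>.\<close>

lemma edges_at:
  assumes v: "v < 7 * N"
  shows "{e \<in> edges (clique_ring N). v \<in> e} = (\<lambda>s. {v, ring_nb N v s}) ` ({..<7} - {v mod 7})"
proof (intro set_eqI iffI)
  fix e assume "e \<in> {e \<in> edges (clique_ring N). v \<in> e}"
  then obtain w s where w: "e = {w, ring_nb N w s}" "w < 7 * N" "s < 7" "s \<noteq> w mod 7" "v \<in> e"
    by (auto simp: clique_ring_def)
  show "e \<in> (\<lambda>s. {v, ring_nb N v s}) ` ({..<7} - {v mod 7})"
  proof (cases "v = w")
    case False
    then have vw: "v = ring_nb N w s" using w by simp
    then have "e = {v, ring_nb N v (w mod 7)}" using w ring_nb_sym[OF w(2-4)] by auto
    moreover have "w mod 7 \<in> {..<7} - {v mod 7}" using vw w ring_nb_mod[OF w(2-4)] by simp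
    ultimately show ?thesis by blast
  qed (use w in auto)
qed (use v in \<open>auto intro: ring_edge\<close>)

lemma simple_clique_ring: "simple_graph (clique_ring N)"
  unfolding simple_graph_def
proof (intro conjI ballI)
  fix e assume "e \<in> edges (clique_ring N)"
  then obtain v s where v: "e = {v, ring_nb N v s}" "v < 7 * N" "s < 7" "s \<noteq> v mod 7"
    by (auto simp: clique_ring_def)
  then have "v \<noteq> ring_nb N v s" using ring_nb_mod[OF v(2-4)] by metis
  then show "card e = 2" using v by simp
  show "e \<subseteq> verts (clique_ring N)"
    using v ring_nb_less[OF v(2-4)] by (simp add: clique_ring_def)
qed (simp add: clique_ring_def)

lemma regular_clique_ring: "regular 6 (clique_ring N)"
  unfolding regular_def degree_def
proof
  fix v assume "v \<in> verts (clique_ring N)"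
  then have v: "v < 7 * N" by (simp add: clique_ring_def)
  have "inj_on (\<lambda>s. {v, ring_nb N v s}) ({..<7} - {v mod 7})"
  proof (rule inj_onI)
    fix s t assume st: "s \<in> {..<7} - {v mod 7}" "t \<in> {..<7} - {v mod 7}"
      "{v, ring_nb N v s} = {v, ring_nb N v t}"
    then have "ring_nb N v s = ring_nb N v t" by (auto simp: doubleton_eq_iff)
    moreover have "ring_nb N v s mod 7 = s" "ring_nb N v t mod 7 = t"
      using st by (auto intro!: ring_nb_mod v)
    ultimately show "s = t" by metis
  qed
  then show "card {e \<in> edges (clique_ring N). v \<in> e} = 6"
    using v by (simp add: edges_at card_image card_Diff_singleton)
qed

text \<open>The numerical order of the vertices is a Hamiltonian cycle: the edge removed from each
  copy joins its first and last vertex, and the edges between copies join consecutive numbers or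
  close the cycle.\<close>

lemma clique_ring_2_connected:
  assumes "0 < N"
  shows "k_connected 2 (clique_ring N)"
proof (rule hamiltonian_cycle_2_connected[of _ "7 * N"])
  show "verts (clique_ring N) = {..<7 * N}" by (simp add: clique_ring_def)
  show "2 < 7 * N" using assms by simp
  show "{i, Suc i} \<in> edges (clique_ring N)" if i: "Suc i < 7 * N" for i
  proof -
    have "ring_nb N i (Suc i mod 7) = Suc i"
    proof (cases "i mod 7 = 6")
      case True
      then show ?thesis using i by (simp add: ring_nb_def mod_Suc)
    next
      case False
      then have "Suc i mod 7 = Suc (i mod 7)" by (simp add: mod_Suc)
      then show ?thesis using False by (auto simp: ring_nb_def)
    qed
    moreover have "Suc i mod 7 \<noteq> i mod 7" by (simp add: mod_Suc)
    ultimately show ?thesis using ring_edge[of i N "Suc i mod 7"] i by simp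
  qed
  have "{7 * N - 1, 0} = {0, ring_nb N 0 6}" by (auto simp: ring_nb_def)
  then show "{7 * N - 1, 0} \<in> edges (clique_ring N)"
    using assms ring_edge[of 0 N 6] by simp
qed

section \<open>The circular chromatic index of the ring\<close>

lemma add_mod_left_cancel:
  fixes s t v n :: nat
  assumes "(v + s) mod n = (v + t) mod n" "s < n" "t < n"
  shows "s = t"
  using assms
proof (induct s t rule: linorder_wlog)
  case (le s t)
  then have "n dvd t - s" using mod_eq_dvd_iff_nat[of "v + s" "v + t" n] by simp
  then show ?case using le dvd_imp_le[of n "t - s"] by linarith
qed simp

text \<open>The neighbours of a vertex represent the six other residues modulo 7 once each, so the
  edge colouring of the complete graph on the residues by the sum of the ends pulls back to the
  ring. Distinct colours in 0, ..., 6 differ by at least 1 and at most 6.\<close>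

lemma clique_ring_colouring:
  "circular_edge_colouring 7 (clique_ring N) (\<lambda>e. real ((\<Sum>e) mod 7))"
proof -
  have col: "\<Sum>{v, ring_nb N v s} mod 7 = (v + s) mod 7" if v: "v < 7 * N" "s < 7" "s \<noteq> v mod 7" for v s
  proof -
    have "v \<noteq> ring_nb N v s" using ring_nb_mod[OF v] v by metis
    then have "\<Sum>{v, ring_nb N v s} = v + ring_nb N v s" by simp
    then show ?thesis using ring_nb_mod[OF v] by (metis mod_add_right_eq)
  qed
  have neq: "\<Sum>e mod 7 \<noteq> \<Sum>f mod 7"
    if ef: "e \<in> edges (clique_ring N)" "f \<in> edges (clique_ring N)" "e \<noteq> f" "e \<inter> f \<noteq> {}" for e f
  proof -
    obtain v where v: "v \<in> e" "v \<in> f" using ef by blast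
    then have vN: "v < 7 * N" using ef simple_clique_ring[of N]
      by (auto simp: simple_graph_def clique_ring_def)
    then have "e \<in> (\<lambda>s. {v, ring_nb N v s}) ` ({..<7} - {v mod 7})"
      "f \<in> (\<lambda>s. {v, ring_nb N v s}) ` ({..<7} - {v mod 7})"
      using edges_at ef v by blast+
    then obtain s t where st: "e = {v, ring_nb N v s}" "s < 7" "s \<noteq> v mod 7"
      "f = {v, ring_nb N v t}" "t < 7" "t \<noteq> v mod 7" by auto
    then have "s \<noteq> t" using ef(3) by blast
    then have "(v + s) mod 7 \<noteq> (v + t) mod 7" using st(2,5) add_mod_left_cancel by blast
    then show ?thesis using col[OF vN st(2,3)] col[OF vN st(5,6)] st(1,4) by simp
  qed
  have dist: "1 \<le> \<bar>real m - real n\<bar> \<and> \<bar>real m - real n\<bar> \<le> 6" if "m \<noteq> n" "m < 7" "n < 7" for m n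
  proof -
    have "m + 1 \<le> n \<or> n + 1 \<le> m" using that by linarith
    then show ?thesis using that by linarith
  qed
  show ?thesis
    unfolding circular_edge_colouring_def
  proof (intro conjI ballI impI; (elim conjE)?)
    fix e f assume "e \<in> edges (clique_ring N)" "f \<in> edges (clique_ring N)" "e \<noteq> f" "e \<inter> f \<noteq> {}"
    then have "\<Sum>e mod 7 \<noteq> \<Sum>f mod 7" by (rule neq)
    then show "1 \<le> \<bar>real (\<Sum>e mod 7) - real (\<Sum>f mod 7)\<bar>"
      "\<bar>real (\<Sum>e mod 7) - real (\<Sum>f mod 7)\<bar> \<le> 7 - 1"
      using dist[of "\<Sum>e mod 7" "\<Sum>f mod 7"] by simp_all
  qed simp_all
qed

lemma clique_ring_boundary:
  assumes N: "2 \<le> N"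
  shows "card {e \<in> edges (clique_ring N). e \<inter> {..<7} \<noteq> {} \<and> \<not> e \<subseteq> {..<7}} = 2"
proof -
  have "{e \<in> edges (clique_ring N). e \<inter> {..<7} \<noteq> {} \<and> \<not> e \<subseteq> {..<7}} = {{0, 7 * N - 1}, {6, 7}}"
    (is "?B = _")
  proof (intro equalityI subsetI)
    fix e assume e: "e \<in> ?B"
    then obtain v where v: "v \<in> e" "v < 7" by auto
    then obtain s where s: "e = {v, ring_nb N v s}" "s < 7" "s \<noteq> v mod 7"
      using edges_at[of v N] e N by auto
    then have "7 \<le> ring_nb N v s" using v e by auto
    then show "e \<in> {{0, 7 * N - 1}, {6, 7}}"
      using s v N by (auto simp: ring_nb_def split: if_splits)
  next
    fix e assume e: "e \<in> {{0, 7 * N - 1}, {6, 7}}"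
    \<comment> \<open>Since \<open>N\<close> is at least 2, vertex 6 is not the last vertex, so its
      edge goes on to 7, and \<open>7 * N - 1\<close> lies outside the first copy.\<close>
    have "ring_nb N 0 6 = 7 * N - 1" "ring_nb N 6 0 = 7" using N by (auto simp: ring_nb_def)
    moreover have "{0, ring_nb N 0 6} \<in> edges (clique_ring N)"
      "{6, ring_nb N 6 0} \<in> edges (clique_ring N)"
      using N by (simp_all add: ring_edge)
    ultimately have "e \<in> edges (clique_ring N)" using e by auto
    moreover have "0 \<in> e \<and> 7 * N - 1 \<in> e \<or> 6 \<in> e \<and> 7 \<in> e" using e by auto
    then have "e \<inter> {..<7} \<noteq> {}" "\<not> e \<subseteq> {..<7}" using N by (fastforce simp: subset_iff)+
    ultimately show "e \<in> ?B" by blast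
  qed
  moreover have "{0, 7 * N - 1} \<noteq> {6, 7}" by (auto simp: doubleton_eq_iff)
  ultimately show ?thesis by simp
qed

text \<open>The colouring by sums attains 7, and the first copy serves as the seven-vertex set for
  the lower bound.\<close>

lemma circular_chromatic_index_clique_ring:
  assumes N: "2 \<le> N"
  shows "circular_chromatic_index (clique_ring N) = 7"
  unfolding circular_chromatic_index_def
proof (rule cInf_eq_minimum)
  show "7 \<in> {r. \<exists>c. circular_edge_colouring r (clique_ring N) c}"
    using clique_ring_colouring by blast
  fix r assume "r \<in> {r. \<exists>c. circular_edge_colouring r (clique_ring N) c}"
  then obtain c where c: "circular_edge_colouring r (clique_ring N) c" by blast
  show "7 \<le> r"
    by (rule circular_colouring_ge_7[OF simple_clique_ring regular_clique_ring _ _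
          clique_ring_boundary[OF N] c]) (use N in \<open>auto simp: clique_ring_def\<close>)
qed

theorem theorem2:
  "\<exists>\<G> :: nat ugraph set.
     infinite \<G> \<and>
     pairwise (\<lambda>G H. \<not> isomorphic G H) \<G> \<and>
     (\<forall>G \<in> \<G>. simple_graph G \<and> k_connected 2 G \<and> regular 6 G \<and>
        circular_chromatic_index G = 7)"
proof (intro exI conjI)
  \<comment> \<open>The number of vertices determines \<open>N\<close>; this yields both infinitely
    many graphs and pairwise non-isomorphism.\<close>
  have card: "card (verts (clique_ring N)) = 7 * N" for N by (simp add: clique_ring_def)
  then have "inj_on clique_ring {2..}"
    by (metis inj_onI mult_cancel1 zero_neq_numeral)
  then show "infinite (clique_ring ` {2..})"
    by (simp add: finite_image_iff infinite_Ici)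
  have "N = M" if "isomorphic (clique_ring N) (clique_ring M)" for N M
    using that bij_betw_same_card card unfolding isomorphic_def
    by (metis mult_cancel1 zero_neq_numeral)
  then show "pairwise (\<lambda>G H. \<not> isomorphic G H) (clique_ring ` {2..})"
    unfolding pairwise_def by blast
  show "\<forall>G \<in> clique_ring ` {2..}. simple_graph G \<and> k_connected 2 G \<and> regular 6 G \<and>
        circular_chromatic_index G = 7"
    using simple_clique_ring regular_clique_ring clique_ring_2_connected
      circular_chromatic_index_clique_ring by auto
qed

end
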